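(* Let $\Gamma$ be a graph of order $n$ with maximum degree $\delta_1$ and minimum degree $\delta_n$, and write $A(\Gamma;x)=x^n\sum_{k\in\mathcal{K}}A_k(\Gamma)x^k$. Let $\mathrm{Deg}_{\min}(A(\Gamma;x))$ and $\mathrm{Deg}(A(\Gamma;x))$ denote the smallest and largest exponents of $x$ appearing with nonzero coefficient. Then: (i) $\mathrm{Deg}_{\min}(A(\Gamma;x))=n-\delta_1$, and $A_{-\delta_1}(\Gamma)$ is the number of vertices of $\Gamma$ of degree $\delta_1$; (ii) $A_{-\delta_1+1}(\Gamma)$ is the number of vertices of $\Gamma$ of degree $\delta_1-1$; (iii) $A_{\delta_n}(\Gamma)>0$; (iv) $n+\delta_n\le \mathrm{Deg}(A(\Gamma;x))\le n+\delta_1$; (v) $A_{\delta_1}(\Gamma)$ equals the number of connected components of $\Gamma$ which are $\delta_1$-regular; (vi) there is no defensive $k$-alliance in $\Gamma$ for any $k>\mathrm{Deg}(A(\Gamma;x))-n$.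
   Context: All graphs are finite and simple with at least one vertex. For $\Gamma=(V,E)$, a vertex $v$ and $X\subseteq V$, $\delta_X(v)$ is the number of neighbours of $v$ in $X$, $\bar S=V\setminus S$, and $\mathcal{K}=[-\delta_1,\delta_1]\cap\mathbb{Z}$. A nonempty $S\subseteq V$ is a defensive $k$-alliance (for an integer $k$) if $\delta_S(v)\ge\delta_{\bar S}(v)+k$ for all $v\in S$; its exact index of alliance is $k_S=\max\{k\in\mathcal{K}: S \text{ is a defensive } k\text{-alliance}\}$. The alliance polynomial is $A(\Gamma;x)=\sum_{S} x^{n+k_S}$, the sum over all nonempty $S\subseteq V$ with induced subgraph $\langle S\rangle$ connected; thus $A_k(\Gamma)$ is the number of nonempty $S$ with $\langle S\rangle$ connected and $k_S=k$. *)

theory Defs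
  imports "Graph_Theory.Graph_Theory" "HOL-Computational_Algebra.Polynomial"
begin

text \<open>
  A finite simple graph is an object of the locale \<^locale>\<open>graph\<close>: a finite, symmetric digraph
  without loops and without parallel arcs, each undirected edge being a pair of opposite arcs.
  The null graph is not excluded by the locale. For symmetric digraphs, the library's
  \<open>Digraph_Component.connected\<close> is the usual connectedness; the qualified name is needed because
  of topological connectedness.
\<close>

definition nbr_count :: "('a,'b) pre_digraph \<Rightarrow> 'a set \<Rightarrow> 'a \<Rightarrow> nat" where
  "nbr_count G X v = card {u \<in> X. v \<rightarrow>\<^bsub>G\<^esub> u}"

definition vdeg :: "('a,'b) pre_digraph \<Rightarrow> 'a \<Rightarrow> nat" where
  "vdeg G v = nbr_count G (verts G) v"

definition max_deg :: "('a,'b) pre_digraph \<Rightarrow> nat" where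
  "max_deg G = Max (vdeg G ` verts G)"

definition min_deg :: "('a,'b) pre_digraph \<Rightarrow> nat" where
  "min_deg G = Min (vdeg G ` verts G)"

definition regular :: "nat \<Rightarrow> ('a,'b) pre_digraph \<Rightarrow> bool" where
  "regular d G \<longleftrightarrow> (\<forall>v \<in> verts G. vdeg G v = d)"

definition components :: "('a,'b) pre_digraph \<Rightarrow> ('a,'b) pre_digraph set" where
  "components G = {H. pre_digraph.max_subgraph G Digraph_Component.connected H}"

definition index_range :: "('a,'b) pre_digraph \<Rightarrow> int set" where
  "index_range G = {- int (max_deg G) .. int (max_deg G)}"

definition defensive_alliance :: "('a,'b) pre_digraph \<Rightarrow> int \<Rightarrow> 'a set \<Rightarrow> bool" where
  "defensive_alliance G k S \<longleftrightarrow> S \<noteq> {} \<and> S \<subseteq> verts G \<and>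
     (\<forall>v \<in> S. int (nbr_count G S v) \<ge> int (nbr_count G (verts G - S) v) + k)"

definition exact_index :: "('a,'b) pre_digraph \<Rightarrow> 'a set \<Rightarrow> int" where
  "exact_index G S = Max {k \<in> index_range G. defensive_alliance G k S}"

definition connected_sets :: "('a,'b) pre_digraph \<Rightarrow> 'a set set" where
  "connected_sets G =
     {S. S \<noteq> {} \<and> S \<subseteq> verts G \<and> Digraph_Component.connected (G \<restriction> S)}"

text \<open>
  The conversion \<^const>\<open>nat\<close> below never truncates: see \<open>exponent_pos\<close>.
\<close>

definition alliance_poly :: "('a,'b) pre_digraph \<Rightarrow> int poly" where
  "alliance_poly G =
     (\<Sum>S \<in> connected_sets G. monom 1 (nat (int (card (verts G)) + exact_index G S)))"

text \<open>
  The coefficient of \<open>x ^ (n + k)\<close>; see \<open>alliance_poly_expansion\<close> and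
  \<open>alliance_coeff_eq_card\<close>. Indices \<open>k < - n\<close> are read as \<open>k = - n\<close>, where the coefficient is zero.
\<close>

definition alliance_coeff :: "('a,'b) pre_digraph \<Rightarrow> int \<Rightarrow> int" where
  "alliance_coeff G k = coeff (alliance_poly G) (nat (int (card (verts G)) + k))"

definition min_degree :: "'a::zero poly \<Rightarrow> nat" where
  "min_degree p = (LEAST i. coeff p i \<noteq> 0)"

lemma nbr_count_le_max_deg:
  assumes "graph G" "v \<in> verts G" "X \<subseteq> verts G"
  shows "nbr_count G X v \<le> max_deg G"
proof -
  interpret graph G by fact
  have "nbr_count G X v \<le> vdeg G v"
    unfolding nbr_count_def vdeg_def using assms(3) by (intro card_mono) auto
  also have "\<dots> \<le> max_deg G"
    unfolding max_deg_def using assms(2) by (intro Max_ge) auto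
  finally show ?thesis .
qed

lemma exact_index_mem:
  assumes "graph G" "S \<noteq> {}" "S \<subseteq> verts G"
  shows "exact_index G S \<in> index_range G" "defensive_alliance G (exact_index G S) S"
proof -
  have "defensive_alliance G (- int (max_deg G)) S"
    unfolding defensive_alliance_def
    using assms nbr_count_le_max_deg[OF assms(1), of _ "verts G - S"]
    by (fastforce simp: subset_iff)
  then have ne: "{k \<in> index_range G. defensive_alliance G k S} \<noteq> {}"
    unfolding index_range_def by force
  have "finite {k \<in> index_range G. defensive_alliance G k S}"
    by (rule finite_subset[of _ "index_range G"]) (auto simp: index_range_def)
  from Max_in[OF this ne] show "exact_index G S \<in> index_range G"
    "defensive_alliance G (exact_index G S) S"
    unfolding exact_index_def by auto
qed

lemma max_deg_less:
  assumes "graph G" "verts G \<noteq> {}"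
  shows "max_deg G < card (verts G)"
proof -
  interpret graph G by fact
  have "vdeg G v < card (verts G)" if "v \<in> verts G" for v
  proof -
    have "{u \<in> verts G. v \<rightarrow>\<^bsub>G\<^esub> u} \<subset> verts G"
      using that adj_not_same by auto
    then show ?thesis
      unfolding vdeg_def nbr_count_def by (intro psubset_card_mono) auto
  qed
  then show ?thesis unfolding max_deg_def using assms(2) by simp
qed

lemma exponent_pos:
  assumes "graph G" "S \<in> connected_sets G"
  shows "int (card (verts G)) + exact_index G S > 0"
proof -
  have S: "S \<noteq> {}" "S \<subseteq> verts G" using assms(2) by (auto simp: connected_sets_def)
  then have "verts G \<noteq> {}" by auto
  with max_deg_less[OF assms(1)] exact_index_mem(1)[OF assms(1) S]
  show ?thesis by (simp add: index_range_def)
qed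

lemma finite_connected_sets:
  assumes "graph G" shows "finite (connected_sets G)"
proof -
  interpret graph G by fact
  show ?thesis unfolding connected_sets_def by simp
qed

lemma alliance_coeff_eq_card:
  assumes "graph G"
  shows "alliance_coeff G k = int (card {S \<in> connected_sets G. exact_index G S = k})"
proof -
  have eq: "nat (int (card (verts G)) + exact_index G S) = nat (int (card (verts G)) + k)
      \<longleftrightarrow> exact_index G S = k" if "S \<in> connected_sets G" for S
    using exponent_pos[OF assms that] by auto
  have "alliance_coeff G k = (\<Sum>S \<in> connected_sets G. if exact_index G S = k then 1 else 0)"
    unfolding alliance_coeff_def alliance_poly_def coeff_sum
    by (intro sum.cong refl) (simp add: eq)
  also have "\<dots> = int (card {S \<in> connected_sets G. exact_index G S = k})"
    using finite_connected_sets[OF assms]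
    by (simp add: sum.If_cases Int_def)
  finally show ?thesis .
qed

lemma alliance_poly_expansion:
  assumes "graph G"
  shows "alliance_poly G =
    (\<Sum>k \<in> index_range G. monom (alliance_coeff G k) (nat (int (card (verts G)) + k)))"
proof -
  have mem: "exact_index G ` connected_sets G \<subseteq> index_range G"
    using exact_index_mem(1)[OF assms] by (auto simp: connected_sets_def)
  have "alliance_poly G = (\<Sum>k \<in> index_range G. \<Sum>S \<in> {S \<in> connected_sets G. exact_index G S = k}.
      monom 1 (nat (int (card (verts G)) + exact_index G S)))"
    unfolding alliance_poly_def
    by (rule sum.group[symmetric]) (use finite_connected_sets[OF assms] mem in
        \<open>auto simp: index_range_def\<close>)
  also have "\<dots> = (\<Sum>k \<in> index_range G.
      monom (alliance_coeff G k) (nat (int (card (verts G)) + k)))"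
    by (intro sum.cong refl)
      (simp add: alliance_coeff_eq_card[OF assms] of_nat_poly smult_monom
        flip: mult_monom)
  finally show ?thesis .
qed

end

theory Submission
  imports Defs
begin

text \<open>
  The exact index of \<open>S\<close> is the minimum of \<open>\<delta>_S(v) - \<delta>_{V-S}(v)\<close> over \<open>v \<in> S\<close>. If it is at most
  \<open>1 - \<delta>1\<close>, then a vertex attaining it has no neighbour in \<open>S\<close>, so a connected \<open>S\<close> is a singleton.
  It equals \<open>\<delta>1\<close> exactly when every vertex of \<open>S\<close> has \<open>\<delta>1\<close> neighbours, all of them in \<open>S\<close>, so
  a connected \<open>S\<close> is then a regular component. On a component the exact index is the smallest degree
  occurring there, and passing from a defensive alliance to a connected component of the
  subgraph that it induces changes no \<open>\<delta>_S(v)\<close>.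
\<close>

section \<open>Degree counts and the exact index as a threshold\<close>

lemma defensive_alliance_mono:
  "defensive_alliance G k S \<Longrightarrow> j \<le> k \<Longrightarrow> defensive_alliance G j S"
  unfolding defensive_alliance_def by force

text \<open>Adding \<open>card (verts G)\<close> back restores \<open>i\<close>, so
  \<open>nat\<close> does not truncate here.\<close>

lemma coeff_alliance_poly:
  "coeff (alliance_poly G) i = alliance_coeff G (int i - int (card (verts G)))"
  by (simp add: alliance_coeff_def)

context graph
begin

lemma finite_subset_verts: "S \<subseteq> verts G \<Longrightarrow> finite S"
  using finite_subset finite_verts by blast

lemma vdeg_split:
  assumes "S \<subseteq> verts G"
  shows "vdeg G v = nbr_count G S v + nbr_count G (verts G - S) v"
proof -
  have "{u \<in> verts G. v \<rightarrow>\<^bsub>G\<^esub> u} = {u \<in> S. v \<rightarrow>\<^bsub>G\<^esub> u} \<union> {u \<in> verts G - S. v \<rightarrow>\<^bsub>G\<^esub> u}"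
    using assms by auto
  then show ?thesis
    unfolding vdeg_def nbr_count_def
    by (simp add: card_Un_disjoint disjoint_iff finite_subset_verts[OF assms])
qed

lemma vdeg_le_max_deg: "v \<in> verts G \<Longrightarrow> vdeg G v \<le> max_deg G"
  unfolding max_deg_def by simp

lemma vdeg_induce_subgraph:
  assumes "v \<in> S"
  shows "vdeg (G \<restriction> S) v = nbr_count G S v"
proof -
  have "{u \<in> S. v \<rightarrow>\<^bsub>G \<restriction> S\<^esub> u} = {u \<in> S. v \<rightarrow>\<^bsub>G\<^esub> u}"
    using assms by (auto simp: arcs_ends_conv image_iff)
  then show ?thesis by (simp add: vdeg_def nbr_count_def)
qed

lemma nbr_count_compl_eq_0_iff:
  "nbr_count G (verts G - S) v = 0 \<longleftrightarrow> (\<forall>w. v \<rightarrow>\<^bsub>G\<^esub> w \<longrightarrow> w \<in> S)"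
  by (auto simp: nbr_count_def dest: adj_in_verts)

text \<open>Alliances persist when \<open>k\<close> is lowered, and restricting to
  \<open>index_range G\<close> loses nothing: a vertex of \<open>S\<close> forces
  \<open>k \<le> max_deg G\<close>, and any \<open>k\<close> below the range lies below the exact
  index.\<close>

lemma le_exact_index_iff:
  assumes "S \<noteq> {}" "S \<subseteq> verts G"
  shows "k \<le> exact_index G S \<longleftrightarrow> defensive_alliance G k S"
proof
  assume "k \<le> exact_index G S"
  then show "defensive_alliance G k S"
    using exact_index_mem(2)[OF graph_axioms assms] defensive_alliance_mono by blast
next
  assume alliance: "defensive_alliance G k S"
  from assms obtain v where "v \<in> S" "v \<in> verts G" by auto
  then have "k \<le> int (max_deg G)"
    using alliance nbr_count_le_max_deg[OF graph_axioms \<open>v \<in> verts G\<close> assms(2)]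
    unfolding defensive_alliance_def by force
  moreover have "- int (max_deg G) \<le> exact_index G S"
    using exact_index_mem(1)[OF graph_axioms assms] by (simp add: index_range_def)
  moreover have "k \<le> exact_index G S" if "k \<in> index_range G"
    unfolding exact_index_def
  proof (rule Max_ge)
    show "finite {k \<in> index_range G. defensive_alliance G k S}"
      by (rule finite_subset[of _ "index_range G"]) (auto simp: index_range_def)
  qed (use that alliance in simp)
  ultimately show "k \<le> exact_index G S"
    unfolding index_range_def by force
qed

lemma exact_index_bounds:
  assumes "S \<in> connected_sets G"
  shows "- int (max_deg G) \<le> exact_index G S" "exact_index G S \<le> int (max_deg G)"
  using exact_index_mem(1)[OF graph_axioms] assms
  by (auto simp: connected_sets_def index_range_def)

section \<open>Connected sets, singletons and the two lowest coefficients\<close>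

text \<open>Induced subgraphs of a symmetric digraph are symmetric, so undirected and directed
  reachability agree on them.\<close>

lemma connected_sets_iff:
  "S \<in> connected_sets G \<longleftrightarrow> S \<subseteq> verts G \<and> strongly_connected (G \<restriction> S)"
proof (cases "S \<subseteq> verts G")
  case True
  interpret S: wf_digraph "G \<restriction> S" by auto
  have "symmetric (G \<restriction> S)"
    using induced_graph_imp_symmetric[OF sym_arcs induced_induce[OF True]] .
  then have "Digraph_Component.connected (G \<restriction> S) \<longleftrightarrow> strongly_connected (G \<restriction> S)"
    by (auto simp: S.symmetric_connected_imp_strongly_connected connected_def
        strongly_connected_def S.reachable_mk_symmetric_eq)
  then show ?thesis
    using True by (auto simp: connected_sets_def strongly_connected_def)
qed (simp add: connected_sets_def)

lemma singleton_connected_sets: "v \<in> verts G \<Longrightarrow> {v} \<in> connected_sets G"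
proof -
  assume v: "v \<in> verts G"
  interpret S: wf_digraph "G \<restriction> {v}" by auto
  show ?thesis
    unfolding connected_sets_iff strongly_connected_def using v by simp
qed

text \<open>A path in \<open>G \<restriction> S\<close> from \<open>v\<close> to another vertex
  would start with an arc to a neighbour of \<open>v\<close> in \<open>S\<close>.\<close>

lemma nbr_count_eq_0_imp_singleton:
  assumes "S \<in> connected_sets G" "v \<in> S" "nbr_count G S v = 0"
  shows "S = {v}"
proof -
  interpret S: wf_digraph "G \<restriction> S" by auto
  have S: "S \<subseteq> verts G" "strongly_connected (G \<restriction> S)"
    using assms(1) by (auto simp: connected_sets_iff)
  have "w = v" if "w \<in> S" for w
  proof -
    have "v \<rightarrow>\<^sup>*\<^bsub>G \<restriction> S\<^esub> w"
      using S assms(2) that by (simp add: strongly_connected_def)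
    then show ?thesis
    proof (cases rule: S.converse_reachable_cases)
      case (step u)
      then have "u \<in> {u \<in> S. v \<rightarrow>\<^bsub>G\<^esub> u}"
        using S.adj_in_verts(2)[OF step(1)] dominates_induce_subgraphD[OF step(1)] by simp
      then show ?thesis
        using assms(3) finite_subset_verts[OF S(1)] by (auto simp: nbr_count_def)
    qed simp
  qed
  then show ?thesis using assms(2) by blast
qed

lemma exact_index_singleton:
  assumes "v \<in> verts G"
  shows "exact_index G {v} = - int (vdeg G v)"
proof -
  have "nbr_count G {v} v = 0"
    unfolding nbr_count_def using adj_not_same by auto
  then have "k \<le> exact_index G {v} \<longleftrightarrow> k \<le> - int (vdeg G v)" for k
    using assms vdeg_split[of "{v}" v]
    by (auto simp: le_exact_index_iff defensive_alliance_def)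
  from this[of "exact_index G {v}"] this[of "- int (vdeg G v)"] show ?thesis by simp
qed

text \<open>
  With \<open>\<delta>_S\<close> and \<open>\<delta>_{V-S}\<close> counting the neighbours inside and outside \<open>S\<close>:
  twice the number of neighbours of \<open>v\<close> inside \<open>S\<close> is \<open>vdeg G v + (\<delta>_S(v) - \<delta>_{V-S}(v))\<close>;
  for a vertex attaining the exact index \<open>k\<close> this is at most 1, so \<open>v\<close> is isolated in \<open>S\<close>.
\<close>
lemma alliance_coeff_lowest:
  assumes "k \<le> 1 - int (max_deg G)"
  shows "alliance_coeff G k = int (card {v \<in> verts G. int (vdeg G v) = - k})"
proof -
  have "{S \<in> connected_sets G. exact_index G S = k} =
      (\<lambda>v. {v}) ` {v \<in> verts G. int (vdeg G v) = - k}" (is "?L = ?R")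
  proof
    show "?L \<subseteq> ?R"
    proof
      fix S assume "S \<in> ?L"
      then have conn: "S \<in> connected_sets G" and k: "exact_index G S = k" by auto
      then have S: "S \<noteq> {}" "S \<subseteq> verts G" by (auto simp: connected_sets_def)
      have "\<not> defensive_alliance G (k + 1) S"
        using le_exact_index_iff[OF S, of "k + 1"] k by simp
      then obtain v where v: "v \<in> S"
        "int (nbr_count G S v) < int (nbr_count G (verts G - S) v) + k + 1"
        using S unfolding defensive_alliance_def by force
      then have "nbr_count G S v = 0"
        using vdeg_split[OF S(2), of v] vdeg_le_max_deg[of v] S(2) assms by auto
      then have "S = {v}"
        using nbr_count_eq_0_imp_singleton conn v(1) by blast
      then show "S \<in> ?R"
        using k S(2) exact_index_singleton[of v] by auto
    qed
    show "?R \<subseteq> ?L"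
      by (auto simp: exact_index_singleton singleton_connected_sets)
  qed
  then show ?thesis
    by (simp add: alliance_coeff_eq_card[OF graph_axioms] card_image)
qed

section \<open>Extreme exponents of the polynomial\<close>

lemma alliance_coeff_pos:
  assumes "S \<in> connected_sets G"
  shows "alliance_coeff G (exact_index G S) > 0"
  using assms finite_connected_sets[OF graph_axioms]
  by (auto simp: alliance_coeff_eq_card[OF graph_axioms] card_gt_0_iff)

lemma alliance_coeff_nonzeroE:
  assumes "alliance_coeff G k \<noteq> 0"
  obtains S where "S \<in> connected_sets G" "exact_index G S = k"
proof -
  have "{S \<in> connected_sets G. exact_index G S = k} \<noteq> {}"
    using assms unfolding alliance_coeff_eq_card[OF graph_axioms] by force
  then show ?thesis using that by blast
qed

lemma exact_index_le_degree:
  assumes "S \<in> connected_sets G"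
  shows "int (card (verts G)) + exact_index G S \<le> int (degree (alliance_poly G))"
proof -
  have "nat (int (card (verts G)) + exact_index G S) \<le> degree (alliance_poly G)"
    using alliance_coeff_pos[OF assms] by (intro le_degree) (simp add: alliance_coeff_def)
  then show ?thesis by linarith
qed

lemma degree_alliance_poly_le: "degree (alliance_poly G) \<le> card (verts G) + max_deg G"
proof (rule degree_le, intro allI impI)
  fix i assume i: "card (verts G) + max_deg G < i"
  show "coeff (alliance_poly G) i = 0"
  proof (rule ccontr)
    assume "coeff (alliance_poly G) i \<noteq> 0"
    then obtain S where "S \<in> connected_sets G" "exact_index G S = int i - int (card (verts G))"
      unfolding coeff_alliance_poly by (rule alliance_coeff_nonzeroE)
    with exact_index_bounds(2) i show False by force
  qed
qed

lemma min_degree_alliance_poly: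
  assumes "verts G \<noteq> {}"
  shows "int (min_degree (alliance_poly G)) = int (card (verts G)) - int (max_deg G)"
proof -
  have less: "max_deg G < card (verts G)"
    by (rule max_deg_less[OF graph_axioms assms])
  have "max_deg G \<in> vdeg G ` verts G"
    unfolding max_deg_def using assms by (intro Max_in) auto
  then obtain v where v: "v \<in> verts G" "vdeg G v = max_deg G" by auto
  \<comment> \<open>The subtraction is on naturals; \<open>less\<close> rules out truncation. The
    nonzero coefficient comes from the singleton of a vertex of maximum degree.\<close>
  have "min_degree (alliance_poly G) = card (verts G) - max_deg G"
    unfolding min_degree_def
  proof (rule Least_equality)
    show "coeff (alliance_poly G) (card (verts G) - max_deg G) \<noteq> 0"
      using alliance_coeff_pos[OF singleton_connected_sets[OF v(1)]] less
      by (simp add: coeff_alliance_poly exact_index_singleton v of_nat_diff)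
  next
    fix i assume "coeff (alliance_poly G) i \<noteq> 0"
    then obtain S where "S \<in> connected_sets G" "exact_index G S = int i - int (card (verts G))"
      unfolding coeff_alliance_poly by (rule alliance_coeff_nonzeroE)
    with exact_index_bounds(1)[of S] show "card (verts G) - max_deg G \<le> i" by simp
  qed
  then show ?thesis using less by simp
qed

section \<open>Components inside a vertex set\<close>

text \<open>The witness is the set of vertices reachable from \<open>u\<close> in
  \<open>G \<restriction> S\<close>. It serves to split a disconnected alliance and, with
  \<open>S = verts G\<close>, to find the component of a vertex.\<close>

lemma connected_set_within:
  assumes "S \<subseteq> verts G" "u \<in> S"
  obtains T where "T \<in> connected_sets G" "u \<in> T" "T \<subseteq> S"
    "\<forall>v \<in> T. {w \<in> S. v \<rightarrow>\<^bsub>G\<^esub> w} \<subseteq> T"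
proof -
  interpret S: sym_digraph "G \<restriction> S"
    using induced_graph_imp_graph induced_induce[OF assms(1)] .
  define T where "T = {w. u \<rightarrow>\<^sup>*\<^bsub>G \<restriction> S\<^esub> w}"
  have "T \<subseteq> S"
    unfolding T_def using S.reachable_in_verts(2) by fastforce
  have "(G \<restriction> S) \<restriction> T \<in> S.sccs"
    unfolding T_def using S.induce_reachable_is_in_sccs assms(2) by simp
  \<comment> \<open>The component lives in \<open>G \<restriction> S\<close>, whereas
    \<open>connected_sets\<close> induces from \<open>G\<close> directly.\<close>
  moreover have "(G \<restriction> S) \<restriction> T = G \<restriction> T"
    using \<open>T \<subseteq> S\<close> by (auto simp: induce_subgraph_def)
  ultimately have "T \<in> connected_sets G"
    using \<open>T \<subseteq> S\<close> assms(1) by (auto simp: connected_sets_iff S.sccs_def)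
  moreover have "u \<in> T"
    using assms(2) by (simp add: T_def)
  moreover have "w \<in> T" if "v \<in> T" "w \<in> S" "v \<rightarrow>\<^bsub>G\<^esub> w" for v w
  proof -
    have "v \<rightarrow>\<^bsub>G \<restriction> S\<^esub> w"
      using that \<open>T \<subseteq> S\<close> by (auto simp: arcs_ends_conv)
    then show ?thesis
      using that(1) S.reachable_adj_trans unfolding T_def by blast
  qed
  ultimately show ?thesis using \<open>T \<subseteq> S\<close> that by blast
qed

text \<open>The polynomial records only connected sets; this carries an arbitrary alliance over to a
  set that its degree sees.\<close>

lemma defensive_alliance_connected_set:
  assumes "defensive_alliance G k S"
  obtains T where "T \<in> connected_sets G" "k \<le> exact_index G T"
proof -
  from assms obtain u where S: "S \<subseteq> verts G" "u \<in> S"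
    by (auto simp: defensive_alliance_def)
  obtain T where T: "T \<in> connected_sets G" "u \<in> T" "T \<subseteq> S"
      "\<forall>v \<in> T. {w \<in> S. v \<rightarrow>\<^bsub>G\<^esub> w} \<subseteq> T"
    using connected_set_within[OF S] by blast
  have "T \<subseteq> verts G" using T(3) S(1) by blast
  have "nbr_count G T v = nbr_count G S v" if "v \<in> T" for v
  proof -
    have "{w \<in> T. v \<rightarrow>\<^bsub>G\<^esub> w} = {w \<in> S. v \<rightarrow>\<^bsub>G\<^esub> w}" using T(3) T(4) that by auto
    then show ?thesis by (simp add: nbr_count_def)
  qed
  \<comment> \<open>Equal inside counts and equal total degree force equal outside counts.\<close>
  then have "defensive_alliance G k T"
    using assms T(2,3) \<open>T \<subseteq> verts G\<close> vdeg_split[OF \<open>T \<subseteq> verts G\<close>] vdeg_split[OF S(1)]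
    unfolding defensive_alliance_def
    by (metis add_left_cancel empty_iff subsetD)
  then have "k \<le> exact_index G T"
    using le_exact_index_iff T(2) \<open>T \<subseteq> verts G\<close> by blast
  with T(1) show ?thesis by (rule that)
qed

lemma min_deg_is_exact_index:
  assumes "verts G \<noteq> {}"
  obtains S where "S \<in> connected_sets G" "exact_index G S = int (min_deg G)"
proof -
  have "min_deg G \<in> vdeg G ` verts G"
    unfolding min_deg_def using assms by (intro Min_in) auto
  then obtain u where u: "u \<in> verts G" "vdeg G u = min_deg G" by auto
  \<comment> \<open>Here \<open>T\<close> is the whole component of \<open>u\<close>: its vertices
    have no neighbour outside, so each difference is a full degree, smallest at
    \<open>u\<close>.\<close>
  obtain T where T: "T \<in> connected_sets G" "u \<in> T" "T \<subseteq> verts G"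
      "\<forall>v \<in> T. {w \<in> verts G. v \<rightarrow>\<^bsub>G\<^esub> w} \<subseteq> T"
    using connected_set_within[OF order_refl u(1)] by blast
  have out: "nbr_count G (verts G - T) v = 0" if "v \<in> T" for v
    using T(4) that by (auto simp: nbr_count_compl_eq_0_iff dest: adj_in_verts)
  have deg: "min_deg G \<le> vdeg G v" if "v \<in> T" for v
    using that T(3) by (auto simp: min_deg_def)
  have "k \<le> exact_index G T \<longleftrightarrow> k \<le> int (min_deg G)" for k
  proof -
    have "k \<le> exact_index G T \<longleftrightarrow> defensive_alliance G k T"
      using le_exact_index_iff T(2,3) by blast
    also have "\<dots> \<longleftrightarrow> (\<forall>v \<in> T. k \<le> int (vdeg G v))"
      using T(2,3) by (auto simp: defensive_alliance_def out vdeg_split[OF T(3)])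
    also have "\<dots> \<longleftrightarrow> k \<le> int (min_deg G)"
      using deg u(2) T(2) by force
    finally show ?thesis .
  qed
  from this[of "exact_index G T"] this[of "int (min_deg G)"]
  have "exact_index G T = int (min_deg G)" by simp
  with T(1) show ?thesis by (rule that)
qed

section \<open>Components of the graph and the top coefficient\<close>

text \<open>\<open>components\<close> compares arbitrary subgraphs under undirected connectedness,
  \<open>sccs\<close> compares vertex sets of induced ones under strong connectedness. Identifying
  them lets components be counted by vertex sets.\<close>

lemma components_eq_sccs: "components G = sccs"
proof -
  \<comment> \<open>A subgraph \<open>H\<close> need not be symmetric, so it may be connected
    without being strongly connected; adding all arcs of \<open>G\<close> between its vertices
    repairs this.\<close>
  have conn_induced: "strongly_connected (G \<restriction> verts H)"
    if "subgraph H G" "Digraph_Component.connected H" for H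
  proof -
    have sub: "verts H \<subseteq> verts G" using that(1) by auto
    interpret R: wf_digraph "G \<restriction> verts H" by auto
    have "spanning H (G \<restriction> verts H)"
      using subgraph_induce_subgraphI2[OF that(1)] by (simp add: spanning_def)
    then have "Digraph_Component.connected (G \<restriction> verts H)"
      using R.connected_spanning_imp_connected that(2) by blast
    then show ?thesis
      using sub connected_sets_iff[of "verts H"]
      by (auto simp: connected_sets_def connected_def strongly_connected_def)
  qed
  have conn: "Digraph_Component.connected H"
    if "subgraph H G" "strongly_connected H" for H
    using that wf_digraph.reachable_mk_symmetricI[of H]
    by (auto simp: connected_def strongly_connected_def subgraph_def)
  \<comment> \<open>Connectedness survives adding arcs on a fixed vertex set, so a maximal connected
    subgraph is induced.\<close>
  have mono: "arc_mono Digraph_Component.connected"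
    unfolding arc_mono_def
    by (metis spanning_def subgraphE wf_digraph.connected_spanning_imp_connected)
  show ?thesis
  proof (intro set_eqI iffI)
    fix H assume "H \<in> components G"
    then have H: "max_subgraph Digraph_Component.connected H"
      by (simp add: components_def)
    have "G \<restriction> verts H = H"
      using induce_eq_iff_induced induced_subgraphI_arc_mono[OF H mono] .
    then have "strongly_connected H"
      using conn_induced[of H] H by (simp add: max_subgraph_def)
    then show "H \<in> sccs"
      using H conn by (auto simp: sccs_altdef2 max_subgraph_def)
  next
    fix H assume H: "H \<in> sccs"
    then have ind: "induced_subgraph H G" and sc: "strongly_connected H"
      by (auto simp: sccs_def)
    have "\<not> Digraph_Component.connected H'"
      if "H \<noteq> H'" "subgraph H H'" "subgraph H' G" for H'
    proof
      assume "Digraph_Component.connected H'"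
      then have "strongly_connected (G \<restriction> verts H')"
        using conn_induced that(3) by blast
      moreover have "induced_subgraph (G \<restriction> verts H') G"
        using that(3) by (intro induced_induce) auto
      ultimately have "\<not> verts H \<subset> verts (G \<restriction> verts H')"
        using H unfolding sccs_def by blast
      moreover have "verts H \<subseteq> verts H'"
        using that(2) by auto
      ultimately have "verts H' = verts H" by auto
      \<comment> \<open>An induced subgraph already has every arc on its vertex set, so
        \<open>H'\<close> would equal \<open>H\<close>.\<close>
      then show False
        using ind that by (auto simp: induced_subgraph_altdef2 max_subgraph_def)
    qed
    then have "max_subgraph Digraph_Component.connected H"
      using ind sc conn by (intro max_subgraphI) auto
    then show "H \<in> components G" by (simp add: components_def)
  qed
qed

text \<open>By symmetry, following an arc gives mutual reachability, so no arc leaves a class;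
  conversely a closed set contains everything reachable from it.\<close>

lemma sccs_verts_eq_closed:
  "sccs_verts = {S \<in> connected_sets G. \<forall>v \<in> S. \<forall>w. v \<rightarrow>\<^bsub>G\<^esub> w \<longrightarrow> w \<in> S}"
proof (intro set_eqI iffI)
  fix S assume S: "S \<in> sccs_verts"
  then have "S \<in> connected_sets G"
    using max_reachable_set.strongly_connected[of G S] sccs_verts_subsets
    by (simp add: connected_sets_iff max_reachable_set_def max_reachable_set_axioms_def wf_digraph)
  moreover have "w \<in> S" if "v \<in> S" "v \<rightarrow>\<^bsub>G\<^esub> w" for v w
    using S that symmetric_reachable'[of v w] unfolding sccs_verts_def by blast
  ultimately show "S \<in> {S \<in> connected_sets G. \<forall>v \<in> S. \<forall>w. v \<rightarrow>\<^bsub>G\<^esub> w \<longrightarrow> w \<in> S}" by blast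
next
  fix S assume "S \<in> {S \<in> connected_sets G. \<forall>v \<in> S. \<forall>w. v \<rightarrow>\<^bsub>G\<^esub> w \<longrightarrow> w \<in> S}"
  then have S: "S \<subseteq> verts G" "strongly_connected (G \<restriction> S)"
    and closed: "\<And>v w. v \<in> S \<Longrightarrow> v \<rightarrow>\<^bsub>G\<^esub> w \<Longrightarrow> w \<in> S"
    by (auto simp: connected_sets_iff)
  have "w \<in> S" if "v \<rightarrow>\<^sup>* w" "v \<in> S" for v w
    using that by (induct rule: reachable_induct) (auto intro: closed)
  moreover have "v \<rightarrow>\<^sup>* w" if "v \<in> S" "w \<in> S" for v w
    using S that by (auto simp: strongly_connected_def intro: reachable_induce_subgraphD)
  moreover have "S \<noteq> {}" using S(2) by (simp add: strongly_connected_def)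
  ultimately show "S \<in> sccs_verts" unfolding sccs_verts_def by blast
qed

text \<open>The count passes from sets \<open>S\<close> to components
  \<open>G \<restriction> S\<close>, injectively because \<open>verts\<close> recovers
  \<open>S\<close>.\<close>

lemma alliance_coeff_max_deg:
  "alliance_coeff G (int (max_deg G)) = int (card {H \<in> components G. regular (max_deg G) H})"
proof -
  let ?d = "max_deg G"
  have "exact_index G S = int ?d \<longleftrightarrow>
      (\<forall>v \<in> S. \<forall>w. v \<rightarrow>\<^bsub>G\<^esub> w \<longrightarrow> w \<in> S) \<and> regular ?d (G \<restriction> S)"
    if conn: "S \<in> connected_sets G" for S
  proof -
    have S: "S \<noteq> {}" "S \<subseteq> verts G" using conn by (auto simp: connected_sets_def)
    \<comment> \<open>With the total at most \<open>?d\<close>, an excess of \<open>?d\<close>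
      inside over outside leaves no outside neighbour and exactly \<open>?d\<close> inside
      ones.\<close>
    have le: "nbr_count G S v + nbr_count G (verts G - S) v \<le> ?d" if "v \<in> S" for v
      using vdeg_le_max_deg[of v] vdeg_split[OF S(2), of v] S(2) that by auto
    have "exact_index G S = int ?d \<longleftrightarrow> int ?d \<le> exact_index G S"
      using exact_index_bounds(2)[OF conn] by auto
    also have "\<dots> \<longleftrightarrow> (\<forall>v \<in> S. nbr_count G (verts G - S) v + ?d \<le> nbr_count G S v)"
      using S by (auto simp: le_exact_index_iff defensive_alliance_def simp flip: of_nat_add)
    also have "\<dots> \<longleftrightarrow>
        (\<forall>v \<in> S. nbr_count G (verts G - S) v = 0 \<and> nbr_count G S v = ?d)"
      using le by fastforce
    also have "\<dots> \<longleftrightarrow> (\<forall>v \<in> S. \<forall>w. v \<rightarrow>\<^bsub>G\<^esub> w \<longrightarrow> w \<in> S) \<and> regular ?d (G \<restriction> S)"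
      unfolding nbr_count_compl_eq_0_iff regular_def
      using vdeg_induce_subgraph by auto
    finally show ?thesis .
  qed
  then have "{S \<in> connected_sets G. exact_index G S = int ?d} =
      {S \<in> sccs_verts. regular ?d (G \<restriction> S)}"
    by (auto simp: sccs_verts_eq_closed)
  moreover have "{H \<in> components G. regular ?d H} =
      (\<restriction>) G ` {S \<in> sccs_verts. regular ?d (G \<restriction> S)}"
    by (auto simp: components_eq_sccs sccs_conv_sccs_verts)
  moreover have "inj_on ((\<restriction>) G) A" for A
    by (rule inj_on_inverseI[where g = verts]) simp
  ultimately show ?thesis
    by (simp add: alliance_coeff_eq_card[OF graph_axioms] card_image)
qed

end

text \<open>The degree \<open>\<delta>1 - 1\<close> is compared over the integers: for an edgeless
  graph no vertex qualifies, while truncated subtraction would count them all. The final clause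
  covers disconnected alliances and every integer \<open>k\<close>.\<close>

theorem theorem2p5:
  fixes G :: "('a,'b) pre_digraph" and n \<delta>1 \<delta>n :: nat
  assumes "graph G" and "verts G \<noteq> {}"
    and "n = card (verts G)" and "\<delta>1 = max_deg G" and "\<delta>n = min_deg G"
  shows
    "(int (min_degree (alliance_poly G)) = int n - int \<delta>1 \<and>
      alliance_coeff G (- int \<delta>1) = int (card {v \<in> verts G. vdeg G v = \<delta>1})) \<and>
     alliance_coeff G (- int \<delta>1 + 1) =
       int (card {v \<in> verts G. int (vdeg G v) = int \<delta>1 - 1}) \<and>
     alliance_coeff G (int \<delta>n) > 0 \<and>
     (n + \<delta>n \<le> degree (alliance_poly G) \<and> degree (alliance_poly G) \<le> n + \<delta>1) \<and>
     alliance_coeff G (int \<delta>1) = int (card {H \<in> components G. regular \<delta>1 H}) \<and>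
     (\<forall>k::int. k > int (degree (alliance_poly G)) - int n \<longrightarrow>
        \<not> (\<exists>S. defensive_alliance G k S))"
proof -
  interpret graph G by fact
  \<comment> \<open>This one set gives both the positive coefficient at \<open>\<delta>n\<close> and
    the lower bound on the degree.\<close>
  obtain S where S: "S \<in> connected_sets G" "exact_index G S = int \<delta>n"
    using min_deg_is_exact_index assms by blast
  have "int n + int \<delta>n \<le> int (degree (alliance_poly G))"
    using exact_index_le_degree[OF S(1)] S(2) assms(3) by simp
  moreover have "\<not> defensive_alliance G k T"
    if k: "k > int (degree (alliance_poly G)) - int n" for k T
  proof
    assume "defensive_alliance G k T"
    then obtain T' where "T' \<in> connected_sets G" "k \<le> exact_index G T'"
      by (rule defensive_alliance_connected_set)
    with exact_index_le_degree[of T'] k assms(3) show False by simp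
  qed
  ultimately show ?thesis
    using min_degree_alliance_poly[OF assms(2)] alliance_coeff_lowest[of "- int \<delta>1"]
      alliance_coeff_lowest[of "- int \<delta>1 + 1"] alliance_coeff_pos[OF S(1)] S(2)
      degree_alliance_poly_le alliance_coeff_max_deg assms
    by auto
qed

end
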